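(* Let $g_0,\ldots,g_m,h_0,\ldots,h_m:\mathbb{R}^d\to\mathbb{R}$ be convex quadratic functions. If $c\in\mathbb{R}^d$ is a feasible solution of the difference-of-convex problem $(\mathrm{DCO})$, then the restricted problem $(\mathrm{R}_c)$ is feasible (i.e. it has at least one feasible solution). Moreover, if $z^*$ is an optimal solution of $(\mathrm{R}_c)$, then $$g_0(c)-h_0(c)\le g_0(z^* )-h_0(z^* ).$$
   Context: The difference-of-convex optimization problem $(\mathrm{DCO})$ is: maximize $g_0(z)-h_0(z)$ over $z\in\mathbb{R}^d$ subject to $g_i(z)-h_i(z)\ge 0$ for all $1\le i\le m$, where $g_0,\ldots,g_m$ and $h_0,\ldots,h_m$ are convex quadratic functions on $\mathbb{R}^d$. For a fixed $c\in\mathbb{R}^d$, put $\underline{g}_i(z;c):=g_i(c)+\nabla g_i(c)^T(z-c)$ for $i=0,1,\ldots,m$ (the linearization of $g_i$ at $c$). The restricted problem $(\mathrm{R}_c)$ is: maximize $\underline{g}_0(z;c)-h_0(z)$ over $z\in\mathbb{R}^d$ subject to $\underline{g}_i(z;c)-h_i(z)\ge 0$ for all $1\le i\le m$. A feasible solution of a problem is a point satisfying all its constraints; an optimal solution is a feasible solution attaining the maximum of the objective over all feasible solutions. *)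

theory Defs
  imports "HOL-Analysis.Analysis"
begin

(* Polynomials of degree at most two, so affine functions are included. Symmetry of the matrix
   is not demanded: replacing it by its symmetric part gives the same function. *)
definition quadratic_function :: "(real ^ 'n \<Rightarrow> real) \<Rightarrow> bool" where
  "quadratic_function f \<longleftrightarrow>
     (\<exists>(A :: real ^ 'n ^ 'n) b k. \<forall>x. f x = x \<bullet> (A *v x) + b \<bullet> x + k)"

definition convex_quadratic :: "(real ^ 'n \<Rightarrow> real) \<Rightarrow> bool" where
  "convex_quadratic f \<longleftrightarrow> quadratic_function f \<and> convex_on UNIV f"

(* Meaningful only where f is differentiable, which quadratic functions are everywhere. *)
definition gradient :: "(real ^ 'n \<Rightarrow> real) \<Rightarrow> real ^ 'n \<Rightarrow> real ^ 'n" where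
  "gradient f x = (THE D. GDERIV f x :> D)"

lemma gradient_eqI:
  assumes "GDERIV f x :> D"
  shows "gradient f x = D"
  unfolding gradient_def
proof (rule the_equality)
  fix D' assume "GDERIV f x :> D'"
  with assms have "(\<lambda>h. h \<bullet> D') = (\<lambda>h. h \<bullet> D)"
    unfolding gderiv_def by (rule has_derivative_unique[rotated])
  then show "D' = D"
    by (metis vector_eq_ldot)
qed (fact assms)

definition linearization ::
    "(real ^ 'n \<Rightarrow> real) \<Rightarrow> real ^ 'n \<Rightarrow> real ^ 'n \<Rightarrow> real" where
  "linearization f c z = f c + gradient f c \<bullet> (z - c)"

(* A problem is given by m and the families g, h: index 0 is the objective, 1, ..., m are the
   constraints, and values at indices above m are irrelevant. *)
definition DCO_objective ::
    "(nat \<Rightarrow> real ^ 'n \<Rightarrow> real) \<Rightarrow> (nat \<Rightarrow> real ^ 'n \<Rightarrow> real) \<Rightarrow> real ^ 'n \<Rightarrow> real" where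
  "DCO_objective g h z = g 0 z - h 0 z"

definition DCO_feasible ::
    "nat \<Rightarrow> (nat \<Rightarrow> real ^ 'n \<Rightarrow> real) \<Rightarrow> (nat \<Rightarrow> real ^ 'n \<Rightarrow> real) \<Rightarrow> real ^ 'n \<Rightarrow> bool" where
  "DCO_feasible m g h z \<longleftrightarrow> (\<forall>i\<in>{1..m}. g i z - h i z \<ge> 0)"

definition R_objective ::
    "(nat \<Rightarrow> real ^ 'n \<Rightarrow> real) \<Rightarrow> (nat \<Rightarrow> real ^ 'n \<Rightarrow> real) \<Rightarrow> real ^ 'n \<Rightarrow> real ^ 'n \<Rightarrow> real" where
  "R_objective g h c z = linearization (g 0) c z - h 0 z"

definition R_feasible ::
    "nat \<Rightarrow> (nat \<Rightarrow> real ^ 'n \<Rightarrow> real) \<Rightarrow> (nat \<Rightarrow> real ^ 'n \<Rightarrow> real) \<Rightarrow> real ^ 'n \<Rightarrow> real ^ 'n \<Rightarrow> bool" where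
  "R_feasible m g h c z \<longleftrightarrow> (\<forall>i\<in>{1..m}. linearization (g i) c z - h i z \<ge> 0)"

definition R_optimal ::
    "nat \<Rightarrow> (nat \<Rightarrow> real ^ 'n \<Rightarrow> real) \<Rightarrow> (nat \<Rightarrow> real ^ 'n \<Rightarrow> real) \<Rightarrow> real ^ 'n \<Rightarrow> real ^ 'n \<Rightarrow> bool" where
  "R_optimal m g h c z \<longleftrightarrow> is_arg_max (R_objective g h c) (R_feasible m g h c) z"

end

theory Submission
  imports Defs
begin

text \<open>
  A convex differentiable function lies above each of its tangents. Hence, for convex \<open>g\<close>, replacing
  \<open>g\<close> by its linearization at \<open>c\<close> gives a global lower bound of \<open>g - h\<close> (lemma
  \<open>linearization_le\<close>), and this bound is exact at \<open>c\<close>. Exactness makes the DCO-feasible point \<open>c\<close>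
  feasible for the restricted problem, with the same objective value in both problems. An optimal
  \<open>z\<close> of the restricted problem therefore has restricted objective value at least
  \<open>g 0 c - h 0 c\<close>, and the lower bound at \<open>z\<close> says that its value in the original problem is no
  smaller.
\<close>

lemma quadratic_function_GDERIV:
  fixes f :: "real ^ 'n \<Rightarrow> real"
  assumes "quadratic_function f"
  obtains D where "GDERIV f x :> D"
proof -
  obtain A :: "real ^ 'n ^ 'n" and b k where f: "f = (\<lambda>x. x \<bullet> (A *v x) + b \<bullet> x + k)"
    using assms unfolding quadratic_function_def by (auto simp: fun_eq_iff)
  have "(f has_derivative (\<lambda>v. x \<bullet> (A *v v) + v \<bullet> (A *v x) + b \<bullet> v)) (at x)"
    unfolding f by (auto intro!: derivative_eq_intros
        bounded_linear.has_derivative[OF matrix_vector_mul_bounded_linear])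
  moreover have "x \<bullet> (A *v v) + v \<bullet> (A *v x) + b \<bullet> v = v \<bullet> (transpose A *v x + A *v x + b)" for v
    by (simp add: inner_add_right inner_commute dot_lmul_matrix[symmetric])
  ultimately have "GDERIV f x :> transpose A *v x + A *v x + b"
    by (simp add: gderiv_def)
  then show thesis by (rule that)
qed

text \<open>
  Restricting to the line from \<open>c\<close> through \<open>z\<close> reduces the tangent inequality to the one for convex
  functions of one real variable.
\<close>

lemma convex_on_above_gradient:
  fixes f :: "'a::real_inner \<Rightarrow> real"
  assumes "convex_on UNIV f" and "GDERIV f c :> D"
  shows "f c + D \<bullet> (z - c) \<le> f z"
proof -
  define \<phi> where "\<phi> t = f (c + t *\<^sub>R (z - c))" for t :: real
  have "convex_on UNIV \<phi>"
  proof (rule convex_onI)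
    fix t x y :: real
    assume t: "0 < t" "t < 1"
    have "c + ((1 - t) * x + t * y) *\<^sub>R (z - c)
        = (1 - t) *\<^sub>R (c + x *\<^sub>R (z - c)) + t *\<^sub>R (c + y *\<^sub>R (z - c))"
      by (simp add: algebra_simps)
    then show "\<phi> ((1 - t) *\<^sub>R x + t *\<^sub>R y) \<le> (1 - t) * \<phi> x + t * \<phi> y"
      using convex_onD[OF assms(1), of t] t by (simp add: \<phi>_def)
  qed simp
  moreover have "(\<phi> has_real_derivative D \<bullet> (z - c)) (at 0)"
  proof -
    have line: "((\<lambda>t. c + t *\<^sub>R (z - c)) has_derivative (\<lambda>t. t *\<^sub>R (z - c))) (at (0::real))"
      by (auto intro!: derivative_eq_intros)
    have "(f has_derivative (\<lambda>v. v \<bullet> D)) (at (c + 0 *\<^sub>R (z - c)))"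
      using assms(2) by (simp add: gderiv_def)
    from has_derivative_compose[OF line this]
    show ?thesis
      by (simp add: \<phi>_def[abs_def] has_field_derivative_def inner_commute mult_commute_abs)
  qed
  ultimately have "\<phi> 1 - \<phi> 0 \<ge> D \<bullet> (z - c) * (1 - 0)"
    by (intro convex_on_imp_above_tangent[of UNIV]) auto
  then show ?thesis by (simp add: \<phi>_def)
qed

lemma linearization_le:
  assumes "convex_quadratic f"
  shows "linearization f c z \<le> f z"
proof -
  obtain D where D: "GDERIV f c :> D"
    using assms quadratic_function_GDERIV unfolding convex_quadratic_def by blast
  show ?thesis
    using convex_on_above_gradient[OF _ D] assms gradient_eqI[OF D]
    by (simp add: linearization_def convex_quadratic_def)
qed

lemma linearization_self: "linearization f c c = f c"
  by (simp add: linearization_def)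

theorem proposition2:
  fixes m :: nat
    and g h :: "nat \<Rightarrow> real ^ 'n \<Rightarrow> real"
    and c :: "real ^ 'n"
  assumes "\<And>i. i \<le> m \<Longrightarrow> convex_quadratic (g i)"
    and "\<And>i. i \<le> m \<Longrightarrow> convex_quadratic (h i)"
    and "DCO_feasible m g h c"
  shows "(\<exists>z. R_feasible m g h c z) \<and>
    (\<forall>zopt. R_optimal m g h c zopt \<longrightarrow> DCO_objective g h c \<le> DCO_objective g h zopt)"
proof (intro conjI allI impI)
  have feasible: "R_feasible m g h c c"
    using assms(3) by (simp add: R_feasible_def DCO_feasible_def linearization_self)
  then show "\<exists>z. R_feasible m g h c z" ..
  fix z assume "R_optimal m g h c z"
  then have "R_objective g h c c \<le> R_objective g h c z"
    using feasible by (auto simp: R_optimal_def is_arg_max_linorder)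
  moreover have "R_objective g h c z \<le> DCO_objective g h z"
    using linearization_le[OF assms(1)[of 0]] by (simp add: R_objective_def DCO_objective_def)
  ultimately show "DCO_objective g h c \<le> DCO_objective g h z"
    by (simp add: R_objective_def DCO_objective_def linearization_self)
qed

end
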